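(* Let $p_1,p_2$ be relatively prime integers, let $\psi$ be a real $2\pi$-periodic smooth function, and consider the steady state $\Psi(x,y)=\psi(p_1x+p_2y)$ of the Euler equation $\nabla^2\Psi_t=\Psi_x(\nabla^2\Psi)_y-\Psi_y(\nabla^2\Psi)_x$ on the torus. Let $k\in\mathbb{Z}\setminus\{0\}$ and $\lambda\in\mathbb{C}$, and set $\mu:=k^2/p^4$, $c:=i\lambda/k$ and $\theta:=k\,\boldsymbol{p}\cdot\boldsymbol{q}/p^2$, where $c$ is not in the range of $\psi'$. Then a mode $\phi(\xi,\eta,t)=f(\eta)\exp(ik\xi+\lambda t)$ with $f$ a $2\pi$-periodic function solves the linearisation of the Euler equation about $\psi$ if and only if $g(\eta):=e^{i\theta\eta}f(\eta)$ solves the Hill's equation $$g''+Q(\eta)g=\mu g,\qquad Q(\eta):=\frac{\psi'''(\eta)}{c-\psi'(\eta)},$$ with quasi-periodic boundary conditions $$g(2\pi)=\exp(2\pi i\theta)\,g(0),\qquad g'(2\pi)=\exp(2\pi i\theta)\,g'(0).$$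
   Context: The torus is $\mathbb{T}^2=[-\pi,\pi]\times[-\pi,\pi]$ with periodic boundary conditions. Write $\boldsymbol{p}=(p_1,p_2)$ and $p^2=p_1^2+p_2^2$. Fix $\boldsymbol{q}=(q_1,q_2)\in\mathbb{Z}^2$ with $p_2q_1-p_1q_2=1$, chosen such that $|\boldsymbol{p}\cdot\boldsymbol{q}|$ is as small as possible, and write $q^2=q_1^2+q_2^2$. The coordinates used are $\xi=q_1x+q_2y$, $\eta=p_1x+p_2y$, in which $\nabla^2=q^2\partial_\xi^2+2\,\boldsymbol{p}\cdot\boldsymbol{q}\,\partial_\xi\partial_\eta+p^2\partial_\eta^2$. The linearisation of the Euler equation about $\psi(\eta)$ for a perturbation $\phi(\xi,\eta,t)$, $2\pi$-periodic in $\xi$ and in $\eta$, is $$\nabla^2\phi_t=p^2\psi'''\phi_\xi-\psi'\nabla^2\phi_\xi,$$ where $'$ denotes $d/d\eta$. (Only $\theta$ modulo $1$ matters in the boundary conditions.) *)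

theory Defs
  imports "HOL-Analysis.Analysis"
begin

definition smooth :: "(real \<Rightarrow> real) \<Rightarrow> bool"
  where "smooth h \<longleftrightarrow> (\<forall>n s. (deriv ^^ n) h differentiable (at s))"

definition periodic_2pi :: "(real \<Rightarrow> 'a) \<Rightarrow> bool"
  where "periodic_2pi h \<longleftrightarrow> (\<forall>s. h (s + 2 * pi) = h s)"


text \<open>
  A field is a function of two space variables and time; it is called with the arguments
  \<open>x y t\<close> or \<open>\<xi> \<eta> t\<close>. Fields on the torus are functions on the plane that are
  \<open>2\<pi>\<close>-periodic in each space variable.
\<close>

type_synonym 'a field = "real \<Rightarrow> real \<Rightarrow> real \<Rightarrow> 'a"

definition pd1 :: "'a::real_normed_vector field \<Rightarrow> 'a field"
  where "pd1 u = (\<lambda>x y t. vector_derivative (\<lambda>s. u s y t) (at x))"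

definition pd2 :: "'a::real_normed_vector field \<Rightarrow> 'a field"
  where "pd2 u = (\<lambda>x y t. vector_derivative (\<lambda>s. u x s t) (at y))"

definition pdt :: "'a::real_normed_vector field \<Rightarrow> 'a field"
  where "pdt u = (\<lambda>x y t. vector_derivative (\<lambda>s. u x y s) (at t))"

definition has_pd1 :: "'a::real_normed_vector field \<Rightarrow> bool"
  where "has_pd1 u \<longleftrightarrow> (\<forall>x y t. (\<lambda>s. u s y t) differentiable (at x))"

definition has_pd2 :: "'a::real_normed_vector field \<Rightarrow> bool"
  where "has_pd2 u \<longleftrightarrow> (\<forall>x y t. (\<lambda>s. u x s t) differentiable (at y))"

definition has_pdt :: "'a::real_normed_vector field \<Rightarrow> bool"
  where "has_pdt u \<longleftrightarrow> (\<forall>x y t. (\<lambda>s. u x y s) differentiable (at t))"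

definition periodic_field :: "'a field \<Rightarrow> bool"
  where "periodic_field u \<longleftrightarrow>
    (\<forall>y t. periodic_2pi (\<lambda>x. u x y t)) \<and> (\<forall>x t. periodic_2pi (\<lambda>y. u x y t))"

text \<open>
  The operator \<open>a \<partial>\<^sub>1\<^sup>2 + 2 b \<partial>\<^sub>1 \<partial>\<^sub>2 + d \<partial>\<^sub>2\<^sup>2\<close>, and the condition that the second-order space
  derivatives in it exist. The Laplacian is \<open>second_order 1 0 1\<close> in the coordinates \<open>x, y\<close>.
\<close>

definition second_order :: "real \<Rightarrow> real \<Rightarrow> real \<Rightarrow> 'a::real_normed_vector field \<Rightarrow> 'a field"
  where "second_order a b d u = (\<lambda>x y t.
    a *\<^sub>R pd1 (pd1 u) x y t + (2 * b) *\<^sub>R pd1 (pd2 u) x y t + d *\<^sub>R pd2 (pd2 u) x y t)"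

definition twice_pd :: "'a::real_normed_vector field \<Rightarrow> bool"
  where "twice_pd u \<longleftrightarrow> has_pd1 u \<and> has_pd2 u \<and>
    has_pd1 (pd1 u) \<and> has_pd1 (pd2 u) \<and> has_pd2 (pd2 u)"


text \<open>
  Solutions are classical: all derivatives appearing in the equation exist everywhere
  (otherwise \<^const>\<open>vector_derivative\<close> is an arbitrary value), and the equation holds pointwise.
\<close>

definition euler_solution :: "real field \<Rightarrow> bool"
  where "euler_solution \<Psi> \<longleftrightarrow>
    (let lap = second_order 1 0 1 in
      periodic_field \<Psi> \<and>
      twice_pd \<Psi> \<and> has_pd1 (lap \<Psi>) \<and> has_pd2 (lap \<Psi>) \<and>
      has_pdt \<Psi> \<and> twice_pd (pdt \<Psi>) \<and>
      (\<forall>x y t. lap (pdt \<Psi>) x y t =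
        pd1 \<Psi> x y t * pd2 (lap \<Psi>) x y t - pd2 \<Psi> x y t * pd1 (lap \<Psi>) x y t))"

definition euler_steady_state :: "(real \<Rightarrow> real \<Rightarrow> real) \<Rightarrow> bool"
  where "euler_steady_state \<Psi> \<longleftrightarrow> euler_solution (\<lambda>x y t. \<Psi> x y)"

definition norm_sq :: "int \<times> int \<Rightarrow> int"
  where "norm_sq v = (fst v)\<^sup>2 + (snd v)\<^sup>2"

definition dot :: "int \<times> int \<Rightarrow> int \<times> int \<Rightarrow> int"
  where "dot v w = fst v * fst w + snd v * snd w"

text \<open>
  Vectors \<open>q\<close> completing \<open>p\<close> to the rows of a unimodular coordinate change
  \<open>\<xi> = q\<^sub>1 x + q\<^sub>2 y\<close>, \<open>\<eta> = p\<^sub>1 x + p\<^sub>2 y\<close>.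
\<close>

definition unimodular_partner :: "int \<times> int \<Rightarrow> int \<times> int \<Rightarrow> bool"
  where "unimodular_partner p q \<longleftrightarrow> snd p * fst q - fst p * snd q = 1"

definition minimal_partner :: "int \<times> int \<Rightarrow> int \<times> int \<Rightarrow> bool"
  where "minimal_partner p q \<longleftrightarrow> unimodular_partner p q \<and>
    (\<forall>r. unimodular_partner p r \<longrightarrow> \<bar>dot p q\<bar> \<le> \<bar>dot p r\<bar>)"

definition laplacian :: "int \<times> int \<Rightarrow> int \<times> int \<Rightarrow> 'a::real_normed_vector field \<Rightarrow> 'a field"
  where "laplacian p q = second_order (of_int (norm_sq q)) (of_int (dot p q)) (of_int (norm_sq p))"

text \<open>
  The linearisation of the Euler equation about \<open>\<psi>(\<eta>)\<close>, in the coordinates \<open>\<xi>, \<eta>\<close>: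
  \<open>\<nabla>\<^sup>2\<phi>\<^sub>t = p\<^sup>2 \<psi>''' \<phi>\<^sub>\<xi> - \<psi>' \<nabla>\<^sup>2\<phi>\<^sub>\<xi>\<close>. Perturbations are complex-valued to admit modes.
\<close>

definition linearised_euler_solution ::
    "int \<times> int \<Rightarrow> int \<times> int \<Rightarrow> (real \<Rightarrow> real) \<Rightarrow> complex field \<Rightarrow> bool"
  where "linearised_euler_solution p q \<psi> \<phi> \<longleftrightarrow>
    periodic_field \<phi> \<and>
    has_pdt \<phi> \<and> twice_pd (pdt \<phi>) \<and> has_pd1 \<phi> \<and> twice_pd (pd1 \<phi>) \<and>
    (\<forall>\<xi> \<eta> t. laplacian p q (pdt \<phi>) \<xi> \<eta> t =
      of_int (norm_sq p) * of_real ((deriv ^^ 3) \<psi> \<eta>) * pd1 \<phi> \<xi> \<eta> t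
      - of_real (deriv \<psi> \<eta>) * laplacian p q (pd1 \<phi>) \<xi> \<eta> t)"

definition mode :: "(real \<Rightarrow> complex) \<Rightarrow> int \<Rightarrow> complex \<Rightarrow> complex field"
  where "mode f k lam = (\<lambda>\<xi> \<eta> t. f \<eta> * exp (\<i> * of_int k * of_real \<xi> + lam * of_real t))"


definition hill_solution :: "(real \<Rightarrow> complex) \<Rightarrow> real \<Rightarrow> (real \<Rightarrow> complex) \<Rightarrow> bool"
  where "hill_solution Q \<mu> g \<longleftrightarrow>
    (let g' = (\<lambda>\<eta>. vector_derivative g (at \<eta>)) in
      (\<forall>\<eta>. g differentiable (at \<eta>)) \<and> (\<forall>\<eta>. g' differentiable (at \<eta>)) \<and>
      (\<forall>\<eta>. vector_derivative g' (at \<eta>) + Q \<eta> * g \<eta> = of_real \<mu> * g \<eta>))"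

definition quasi_periodic_bc :: "real \<Rightarrow> (real \<Rightarrow> complex) \<Rightarrow> bool"
  where "quasi_periodic_bc \<theta> g \<longleftrightarrow>
    g (2 * pi) = exp (2 * of_real pi * \<i> * of_real \<theta>) * g 0 \<and>
    vector_derivative g (at (2 * pi)) =
      exp (2 * of_real pi * \<i> * of_real \<theta>) * vector_derivative g (at 0)"

end

theory Submission
  imports Defs
begin

text \<open>
  A shear flow is steady because both of its space derivatives, and those of its vorticity, are
  multiples of functions of \<open>\<eta>\<close> by the components of \<open>p\<close>, so that the two products in the
  nonlinear term coincide (\<open>plane_wave_steady\<close>).

  On a mode with amplitude \<open>f\<close> every derivative acts on the amplitude alone, and the Laplacian
  becomes an ordinary differential operator \<open>L\<close> (\<open>mode_laplacian\<close>). Cancelling the exponential,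
  the linearised equation is \<open>(\<lambda> + \<i> k \<psi>') L f = \<i> k p\<^sup>2 \<psi>''' f\<close>. Since \<open>\<lambda> = - \<i> k c\<close> and \<open>c - \<psi>'\<close>
  never vanishes, this says \<open>L f + p\<^sup>2 Q f = 0\<close>. The factor \<open>exp (\<i> \<theta> \<eta>)\<close> completes the square in
  \<open>L\<close>, removing its first-order term: up to that factor, \<open>L f / p\<^sup>2\<close> is \<open>g'' - \<mu> g\<close>, with
  \<open>\<mu> = k\<^sup>2 / p\<^sup>4\<close> because Lagrange's identity and unimodularity give
  \<open>p\<^sup>2 q\<^sup>2 - (p \<cdot> q)\<^sup>2 = 1\<close> (\<open>mode_laplacian_twist\<close>).

  Periodicity of \<open>f\<close> is the condition \<open>g (\<eta> + 2\<pi>) = exp (2\<pi> \<i> \<theta>) g \<eta>\<close> for all \<open>\<eta>\<close>, of which the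
  boundary conditions are the value and the slope at \<open>\<eta> = 0\<close>. Conversely, the difference of the
  two sides solves Hill's equation, as \<open>Q\<close> is periodic, and has vanishing initial data; so it is
  zero by uniqueness for linear equations (\<open>linear_ode_unique\<close>).
\<close>

section \<open>Derivatives of smooth periodic profiles\<close>

lemma smooth_has_derivative:
  assumes "smooth h"
  shows "((deriv ^^ n) h has_real_derivative (deriv ^^ Suc n) h s) (at s)"
  using assms unfolding smooth_def by (simp add: DERIV_deriv_iff_real_differentiable)

lemma smooth_continuous:
  assumes "smooth h"
  shows "continuous_on UNIV ((deriv ^^ n) h)"
  using smooth_has_derivative[OF assms] by (metis DERIV_isCont continuous_at_imp_continuous_on)

lemma periodic_deriv:
  fixes h :: "real \<Rightarrow> real"
  assumes "periodic_2pi h"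
  shows "periodic_2pi ((deriv ^^ n) h)"
proof (induction n)
  case 0
  show ?case using assms by simp
next
  case (Suc n)
  let ?u = "(deriv ^^ n) h"
  \<comment> \<open>The derivative relations at the two points are the same predicate, so the definite
    descriptions by which \<^const>\<open>deriv\<close> is defined agree.\<close>
  have "(\<lambda>s. ?u (s + 2 * pi)) = ?u"
    using Suc by (simp add: periodic_2pi_def)
  then have "(?u has_real_derivative D) (at (s + 2 * pi)) = (?u has_real_derivative D) (at s)" for D s
    using DERIV_shift[of ?u D s "2 * pi"] by simp
  then have "deriv ?u (s + 2 * pi) = deriv ?u s" for s
    by (simp add: deriv_def)
  then show ?case by (simp add: periodic_2pi_def)
qed

lemma periodic_2pi_int_shift:
  assumes "periodic_2pi h"
  shows "h (s + 2 * pi * of_int n) = h s"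
proof (induction n rule: int_induct[where k = 0])
  case base
  show ?case by simp
next
  case (step1 i)
  have "h (s + 2 * pi * of_int (i + 1)) = h ((s + 2 * pi * of_int i) + 2 * pi)"
    by (simp add: algebra_simps)
  with step1 assms show ?case by (simp add: periodic_2pi_def)
next
  case (step2 i)
  have "h ((s + 2 * pi * of_int (i - 1)) + 2 * pi) = h (s + 2 * pi * of_int i)"
    by (simp add: algebra_simps)
  with step2 assms show ?case by (simp add: periodic_2pi_def)
qed

section \<open>Steadiness of shear flows\<close>

lemma vector_derivative_plane_wave:
  fixes a b :: real
  assumes "\<And>s. (h has_real_derivative h' s) (at s)"
  shows "((\<lambda>x. h (a * x + b)) has_vector_derivative a * h' (a * x + b)) (at x)"
    and "((\<lambda>x. h (b + a * x)) has_vector_derivative a * h' (b + a * x)) (at x)"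
proof -
  have "((\<lambda>x. h (a * x + b)) has_real_derivative h' (a * x + b) * a) (at x)"
    by (rule DERIV_chain2[OF assms]) (auto intro!: derivative_eq_intros)
  then show "((\<lambda>x. h (a * x + b)) has_vector_derivative a * h' (a * x + b)) (at x)"
    by (simp add: has_real_derivative_iff_has_vector_derivative mult.commute)
  then show "((\<lambda>x. h (b + a * x)) has_vector_derivative a * h' (b + a * x)) (at x)"
    by (simp add: add.commute)
qed

definition plane_wave :: "real \<Rightarrow> real \<Rightarrow> (real \<Rightarrow> real) \<Rightarrow> real field"
  where "plane_wave a b h = (\<lambda>x y t. h (a * x + b * y))"

lemma plane_wave_pd:
  assumes "\<And>s. (h has_real_derivative h' s) (at s)"
  shows "has_pd1 (plane_wave a b h)" "has_pd2 (plane_wave a b h)"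
    and "pd1 (plane_wave a b h) = plane_wave a b (\<lambda>s. a * h' s)"
    and "pd2 (plane_wave a b h) = plane_wave a b (\<lambda>s. b * h' s)"
  using vector_derivative_plane_wave[of h h', OF assms]
  by (auto simp: has_pd1_def has_pd2_def pd1_def pd2_def plane_wave_def fun_eq_iff
      intro!: vector_derivative_at differentiableI_vector)

lemma plane_wave_pdt:
  "has_pdt (plane_wave a b h)" "pdt (plane_wave a b h) = plane_wave a b (\<lambda>s. 0)"
  by (auto simp: has_pdt_def pdt_def plane_wave_def)

lemma periodic_field_plane_wave:
  assumes "periodic_2pi h"
  shows "periodic_field (plane_wave (of_int m) (of_int n) h)"
proof -
  have "h (of_int m * (x + 2 * pi) + of_int n * y) = h (of_int m * x + of_int n * y)" for x y
    using periodic_2pi_int_shift[OF assms, of "of_int m * x + of_int n * y" m]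
    by (simp add: algebra_simps)
  moreover have "h (of_int m * x + of_int n * (y + 2 * pi)) = h (of_int m * x + of_int n * y)" for x y
    using periodic_2pi_int_shift[OF assms, of "of_int m * x + of_int n * y" n]
    by (simp add: algebra_simps)
  ultimately show ?thesis
    by (simp add: periodic_field_def plane_wave_def periodic_2pi_def)
qed

text \<open>
  The vorticity is \<open>(a\<^sup>2 + b\<^sup>2) \<psi>''\<close>, again a plane wave with the same direction; so its gradient is
  parallel to that of the stream function and the nonlinear term vanishes.
\<close>

lemma plane_wave_steady:
  assumes "smooth \<psi>" "periodic_2pi \<psi>"
  shows "euler_steady_state (\<lambda>x y. \<psi> (of_int m * x + of_int n * y))"
proof -
  define a b where "a = real_of_int m" and "b = real_of_int n"
  define D where "D = (\<lambda>j. (deriv ^^ j) \<psi>)"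
  have D: "(D j has_real_derivative D (Suc j) s) (at s)" for j s
    unfolding D_def by (rule smooth_has_derivative[OF assms(1)])
  have cD: "((\<lambda>s. r * D j s) has_real_derivative r * D (Suc j) s) (at s)" for r j s
    by (rule DERIV_cmult[OF D])
  note pd = plane_wave_pd[of "D j" "D (Suc j)" for j, OF D] plane_wave_pdt
    plane_wave_pd[of "\<lambda>s. r * D j s" "\<lambda>s. r * D (Suc j) s" for r j, OF cD]
  have zero: "twice_pd (plane_wave a b (\<lambda>s. 0))" 
      "second_order 1 0 1 (plane_wave a b (\<lambda>s. 0)) = (\<lambda>x y t. 0)"
    by (simp_all add: twice_pd_def second_order_def has_pd1_def has_pd2_def pd1_def pd2_def plane_wave_def)
  have twice: "twice_pd (plane_wave a b (D 0))"
    by (simp add: twice_pd_def pd)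
  have lap: "second_order 1 0 1 (plane_wave a b (D 0)) = plane_wave a b (\<lambda>s. (a\<^sup>2 + b\<^sup>2) * D 2 s)"
    by (simp add: second_order_def pd numeral_2_eq_2)
       (simp add: plane_wave_def fun_eq_iff algebra_simps power2_eq_square)
  have "euler_solution (plane_wave a b (D 0))"
    unfolding euler_solution_def Let_def lap
    using periodic_field_plane_wave[of "D 0" m n] assms(2)
    by (simp add: pd zero twice a_def[symmetric] b_def[symmetric])
       (simp add: plane_wave_def D_def)
  then show ?thesis
    by (simp add: euler_steady_state_def plane_wave_def D_def a_def b_def)
qed

section \<open>Uniqueness for second-order linear equations\<close>

text \<open>
  An energy estimate: \<open>E = \<bar>h\<bar>\<^sup>2 + \<bar>h'\<bar>\<^sup>2\<close> satisfies \<open>E' \<le> (1 + B) E\<close> on \<open>[0, t]\<close> when \<open>B\<close> bounds the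
  coefficient there, so \<open>E exp (- (1 + B) s)\<close> decreases from its initial value \<open>0\<close>.
\<close>

lemma linear_ode_unique_forward:
  fixes h h' R :: "real \<Rightarrow> complex"
  assumes h: "\<And>s. (h has_vector_derivative h' s) (at s)"
    and h': "\<And>s. (h' has_vector_derivative R s * h s) (at s)"
    and R: "continuous_on UNIV R"
    and init: "h 0 = 0" "h' 0 = 0" and "0 \<le> t"
  shows "h t = 0"
proof -
  have "compact (R ` {0..t})"
    by (rule compact_continuous_image[OF continuous_on_subset[OF R]]) auto
  then obtain B where "\<forall>z \<in> R ` {0..t}. norm z \<le> B"
    using compact_imp_bounded bounded_iff by blast
  then have B: "norm (R s) \<le> B" if "s \<in> {0..t}" for s using that by blast
  define K where "K = 1 + B"
  define E where "E = (\<lambda>s. h s \<bullet> h s + h' s \<bullet> h' s)"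
  define E' where "E' = (\<lambda>s. 2 * (h s \<bullet> h' s) + 2 * (h' s \<bullet> (R s * h s)))"
  have dE: "(E has_real_derivative E' s) (at s)" for s
    unfolding E_def E'_def has_real_derivative_iff_has_vector_derivative
    by (auto intro!: derivative_eq_intros
        bounded_bilinear.has_vector_derivative[OF bounded_bilinear_inner h h]
        bounded_bilinear.has_vector_derivative[OF bounded_bilinear_inner h' h']
        simp: inner_commute)
  have bound: "E' s \<le> K * E s" if s: "s \<in> {0..t}" for s
  proof -
    have amgm: "2 * (x * y) \<le> x\<^sup>2 + y\<^sup>2" for x y :: real
      using sum_squares_bound[of x y] by simp
    have *: "h s \<bullet> h' s \<le> norm (h s) * norm (h' s)"
      by (rule norm_cauchy_schwarz)
    have "h' s \<bullet> (R s * h s) \<le> norm (h' s) * norm (R s * h s)"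
      by (rule norm_cauchy_schwarz)
    also have "\<dots> = norm (R s) * (norm (h s) * norm (h' s))"
      by (simp add: norm_mult)
    also have "\<dots> \<le> B * (norm (h s) * norm (h' s))"
      by (rule mult_right_mono[OF B[OF s]]) simp
    finally have "E' s \<le> K * (2 * (norm (h s) * norm (h' s)))"
      using * unfolding E'_def K_def by (simp add: algebra_simps)
    also have "\<dots> \<le> K * E s"
    proof (rule mult_left_mono)
      show "2 * (norm (h s) * norm (h' s)) \<le> E s"
        unfolding E_def using amgm by (simp add: power2_norm_eq_inner[symmetric])
      show "0 \<le> K"
        unfolding K_def using B[OF s] norm_ge_zero[of "R s"] by linarith
    qed
    finally show ?thesis .
  qed
  have "E t * exp (- K * t) \<le> E 0 * exp (- K * 0)"
  proof (rule DERIV_nonpos_imp_nonincreasing[OF \<open>0 \<le> t\<close>])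
    fix s assume s: "0 \<le> s" "s \<le> t"
    have "((\<lambda>s. E s * exp (- K * s)) has_real_derivative (E' s - K * E s) * exp (- K * s)) (at s)"
      by (auto intro!: derivative_eq_intros dE simp: algebra_simps)
    moreover have "(E' s - K * E s) * exp (- K * s) \<le> 0"
      using bound[of s] s by (intro mult_nonpos_nonneg) auto
    ultimately show "\<exists>y. ((\<lambda>s. E s * exp (- K * s)) has_real_derivative y) (at s) \<and> y \<le> 0"
      by blast
  qed
  then have "E t \<le> 0"
    using init by (simp add: E_def mult_le_0_iff)
  then show ?thesis
    unfolding E_def using inner_ge_zero[of "h t"] inner_ge_zero[of "h' t"] inner_eq_zero_iff[of "h t"]
    by linarith
qed

text \<open>
  Negative times reduce to positive ones: a second-order equation without first-order term keeps
  its form under time reversal.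
\<close>

lemma linear_ode_unique:
  fixes h h' R :: "real \<Rightarrow> complex"
  assumes h: "\<And>s. (h has_vector_derivative h' s) (at s)"
    and h': "\<And>s. (h' has_vector_derivative R s * h s) (at s)"
    and R: "continuous_on UNIV R"
    and init: "h 0 = 0" "h' 0 = 0"
  shows "h t = 0"
proof (cases "0 \<le> t")
  case True
  then show ?thesis using linear_ode_unique_forward[OF h h' R init] by blast
next
  case False
  have refl: "((\<lambda>s. u (- s)) has_vector_derivative - u' (- s)) (at s)"
    if "\<And>s. (u has_vector_derivative u' s) (at s)" for u u' :: "real \<Rightarrow> complex" and s
  proof -
    have "((u \<circ> uminus) has_vector_derivative (- 1) *\<^sub>R u' (- s)) (at s)"
      by (rule vector_diff_chain_at)
         (auto intro!: derivative_eq_intros that)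
    then show ?thesis by (simp add: o_def)
  qed
  have "((\<lambda>s. - h' (- s)) has_vector_derivative R (- s) * h (- s)) (at s)" for s
    using has_vector_derivative_minus[OF refl[of h' "\<lambda>s. R s * h s", OF h']] by simp
  moreover have "continuous_on UNIV (\<lambda>s. R (- s))"
    by (rule continuous_on_compose2[OF R]) (auto intro!: continuous_intros)
  ultimately have "h (- (- t)) = 0"
    using linear_ode_unique_forward[of "\<lambda>s. h (- s)" "\<lambda>s. - h' (- s)" "\<lambda>s. R (- s)" "- t"]
      refl[of h h', OF h] init False by simp
  then show ?thesis by simp
qed

section \<open>Calculus of modes\<close>

definition vd :: "(real \<Rightarrow> complex) \<Rightarrow> real \<Rightarrow> complex"
  where "vd F = (\<lambda>s. vector_derivative F (at s))"

definition twice_differentiable :: "(real \<Rightarrow> complex) \<Rightarrow> bool"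
  where "twice_differentiable F \<longleftrightarrow> (\<forall>s. F differentiable (at s)) \<and> (\<forall>s. vd F differentiable (at s))"

lemma twice_differentiableI:
  assumes "\<And>s. (F has_vector_derivative F' s) (at s)"
    and "\<And>s. (F' has_vector_derivative F'' s) (at s)"
  shows "twice_differentiable F" "vd F = F'" "vd (vd F) = F''"
proof -
  show *: "vd F = F'" using assms(1) by (auto simp: vd_def fun_eq_iff intro: vector_derivative_at)
  show "vd (vd F) = F''"
    unfolding * using assms(2) by (auto simp: vd_def fun_eq_iff intro: vector_derivative_at)
  show "twice_differentiable F"
    unfolding twice_differentiable_def * using assms differentiableI_vector by blast
qed

lemma twice_differentiableD:
  assumes "twice_differentiable F"
  shows "(F has_vector_derivative vd F s) (at s)" "(vd F has_vector_derivative vd (vd F) s) (at s)"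
  using assms unfolding twice_differentiable_def vd_def
  by (simp_all add: vector_derivative_works[symmetric])

lemma mode_pd1: "has_pd1 (mode F k lam)" "pd1 (mode F k lam) = mode (\<lambda>s. \<i> * of_int k * F s) k lam"
proof -
  have "((\<lambda>x. mode F k lam x y t) has_vector_derivative mode (\<lambda>s. \<i> * of_int k * F s) k lam x y t) (at x)"
    for x y t
    unfolding mode_def
    by (rule has_vector_derivative_eq_rhs, rule has_vector_derivative_mult_right,
        rule field_vector_diff_chain_at[where f = "\<lambda>x. \<i> * of_int k * of_real x + lam * of_real t" and g = exp, unfolded o_def])
       (auto intro!: derivative_eq_intros)
  then show "has_pd1 (mode F k lam)" "pd1 (mode F k lam) = mode (\<lambda>s. \<i> * of_int k * F s) k lam"
    by (auto simp: has_pd1_def pd1_def fun_eq_iff intro!: vector_derivative_at differentiableI_vector)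
qed

lemma mode_pdt: "has_pdt (mode F k lam)" "pdt (mode F k lam) = mode (\<lambda>s. lam * F s) k lam"
proof -
  have "((\<lambda>t. mode F k lam x y t) has_vector_derivative mode (\<lambda>s. lam * F s) k lam x y t) (at t)"
    for x y t
    unfolding mode_def
    by (rule has_vector_derivative_eq_rhs, rule has_vector_derivative_mult_right,
        rule field_vector_diff_chain_at[where f = "\<lambda>t. \<i> * of_int k * of_real x + lam * of_real t" and g = exp, unfolded o_def])
       (auto intro!: derivative_eq_intros)
  then show "has_pdt (mode F k lam)" "pdt (mode F k lam) = mode (\<lambda>s. lam * F s) k lam"
    by (auto simp: has_pdt_def pdt_def fun_eq_iff intro!: vector_derivative_at differentiableI_vector)
qed

lemma mode_pd2:
  assumes "\<And>s. (F has_vector_derivative F' s) (at s)"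
  shows "has_pd2 (mode F k lam)" "pd2 (mode F k lam) = mode F' k lam"
proof -
  have "((\<lambda>y. mode F k lam x y t) has_vector_derivative mode F' k lam x y t) (at y)" for x y t
    unfolding mode_def by (rule has_vector_derivative_mult_left[OF assms])
  then show "has_pd2 (mode F k lam)" "pd2 (mode F k lam) = mode F' k lam"
    by (auto simp: has_pd2_def pd2_def fun_eq_iff intro!: vector_derivative_at differentiableI_vector)
qed

text \<open>
  The exponential factor equals \<open>1\<close> at \<open>\<xi> = t = 0\<close>, so the amplitude is itself a slice of the mode.
  Hence regularity of the field forces regularity of the amplitude.
\<close>

lemma has_pd2_mode_imp_differentiable:
  assumes "has_pd2 (mode F k lam)"
  shows "F differentiable (at s)"
proof -
  have "(\<lambda>y. mode F k lam 0 y 0) differentiable (at s)"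
    using assms by (simp add: has_pd2_def)
  then show ?thesis by (simp add: mode_def)
qed

lemma twice_pd_mode: "twice_pd (mode F k lam) \<longleftrightarrow> twice_differentiable F"
proof
  assume *: "twice_pd (mode F k lam)"
  then have 1: "F differentiable (at s)" for s
    using has_pd2_mode_imp_differentiable twice_pd_def by blast
  have "pd2 (mode F k lam) = mode (vd F) k lam"
    by (rule mode_pd2) (simp add: vd_def vector_derivative_works[symmetric] 1)
  then have "vd F differentiable (at s)" for s
    using * has_pd2_mode_imp_differentiable unfolding twice_pd_def by metis
  with 1 show "twice_differentiable F" by (simp add: twice_differentiable_def)
next
  assume "twice_differentiable F"
  note d = twice_differentiableD[OF this]
  show "twice_pd (mode F k lam)"
    by (simp add: twice_pd_def mode_pd1 mode_pd2[OF d(1)] mode_pd2[OF d(2)])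
qed

lemma twice_differentiable_cmult:
  assumes "twice_differentiable F"
  shows "twice_differentiable (\<lambda>s. a * F s)"
    and "vd (\<lambda>s. a * F s) = (\<lambda>s. a * vd F s)"
    and "vd (vd (\<lambda>s. a * F s)) = (\<lambda>s. a * vd (vd F) s)"
  using twice_differentiableI[OF has_vector_derivative_mult_right has_vector_derivative_mult_right,
      OF twice_differentiableD[OF assms]]
  by blast+

lemma twice_differentiable_cmult_iff:
  assumes "a \<noteq> 0"
  shows "twice_differentiable (\<lambda>s. a * F s) \<longleftrightarrow> twice_differentiable F"
  using twice_differentiable_cmult(1)[of F a] twice_differentiable_cmult(1)[of "\<lambda>s. a * F s" "inverse a"] assms
  by (auto simp: mult.assoc[symmetric])

text \<open>
  The Laplacian with \<open>\<partial>\<^sub>\<xi>\<close> replaced by \<open>\<i> k\<close>, acting on amplitudes.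
\<close>

definition mode_laplacian :: "int \<times> int \<Rightarrow> int \<times> int \<Rightarrow> int \<Rightarrow> (real \<Rightarrow> complex) \<Rightarrow> real \<Rightarrow> complex"
  where "mode_laplacian p q k F = (\<lambda>s. - of_int (norm_sq q) * (of_int k)\<^sup>2 * F s
    + 2 * of_int (dot p q) * \<i> * of_int k * vd F s + of_int (norm_sq p) * vd (vd F) s)"

lemma laplacian_mode:
  assumes "twice_differentiable F"
  shows "laplacian p q (mode F k lam) = mode (mode_laplacian p q k F) k lam"
proof -
  note d = twice_differentiableD[OF assms]
  show ?thesis
    by (simp add: laplacian_def second_order_def mode_pd1 mode_pd2[OF d(1)] mode_pd2[OF d(2)])
       (simp add: mode_def mode_laplacian_def fun_eq_iff scaleR_conv_of_real algebra_simps power2_eq_square)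
qed

lemma mode_laplacian_cmult:
  assumes "twice_differentiable F"
  shows "mode_laplacian p q k (\<lambda>s. a * F s) s = a * mode_laplacian p q k F s"
  unfolding mode_laplacian_def twice_differentiable_cmult(3)[OF assms]
  by (simp add: twice_differentiable_cmult(2)[OF assms] algebra_simps)

lemma periodic_field_mode:
  assumes "periodic_2pi f"
  shows "periodic_field (mode f k lam)"
proof -
  have "exp (\<i> * of_int k * of_real (x + 2 * pi) + lam * of_real t)
      = exp (\<i> * of_int k * of_real x + lam * of_real t)" for x t
  proof -
    have "\<i> * of_int k * of_real (x + 2 * pi) + lam * of_real t
        = (\<i> * of_int k * of_real x + lam * of_real t) + (2 * of_int k * of_real pi) * \<i>"
      by (simp add: algebra_simps)
    moreover have "exp ((2 * of_int k * of_real pi) * \<i>) = (1::complex)"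
      using exp_2pi_1_int[of k] by (simp add: mult_ac)
    ultimately show ?thesis by (simp only: exp_add mult_1_right)
  qed
  with assms show ?thesis
    by (simp add: periodic_field_def periodic_2pi_def mode_def)
qed

text \<open>
  After the common exponential is cancelled, the equation depends on \<open>\<eta>\<close> alone. Existence of the
  second derivatives of \<open>f\<close> comes from the term with \<open>\<phi>\<^sub>\<xi>\<close>, whose amplitude \<open>\<i> k f\<close> is a nonzero
  multiple of \<open>f\<close>; the amplitude \<open>\<lambda> f\<close> of \<open>\<phi>\<^sub>t\<close> would say nothing when \<open>\<lambda> = 0\<close>.
\<close>

lemma linearised_mode_iff:
  assumes "periodic_2pi f" "k \<noteq> 0"
  shows "linearised_euler_solution p q \<psi> (mode f k lam) \<longleftrightarrow> twice_differentiable f \<and>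
    (\<forall>s. (lam + \<i> * of_int k * of_real (deriv \<psi> s)) * mode_laplacian p q k f s
      = \<i> * of_int k * of_int (norm_sq p) * of_real ((deriv ^^ 3) \<psi> s) * f s)"
    (is "?L \<longleftrightarrow> _ \<and> ?E")
proof -
  have k: "\<i> * of_int k \<noteq> (0::complex)" using assms by simp
  have "?L \<longleftrightarrow> ?E" if f: "twice_differentiable f"
  proof -
    have "laplacian p q (pdt (mode f k lam)) x s t =
        of_int (norm_sq p) * of_real ((deriv ^^ 3) \<psi> s) * pd1 (mode f k lam) x s t
        - of_real (deriv \<psi> s) * laplacian p q (pd1 (mode f k lam)) x s t
      \<longleftrightarrow> (lam + \<i> * of_int k * of_real (deriv \<psi> s)) * mode_laplacian p q k f s
      = \<i> * of_int k * of_int (norm_sq p) * of_real ((deriv ^^ 3) \<psi> s) * f s" (is "?P \<longleftrightarrow> ?R") for x s t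
    proof -
      define E where "E = exp (\<i> * of_int k * of_real x + lam * of_real t)"
      have "E \<noteq> 0" by (simp add: E_def)
      have "?P \<longleftrightarrow> lam * mode_laplacian p q k f s * E =
        of_int (norm_sq p) * of_real ((deriv ^^ 3) \<psi> s) * (\<i> * of_int k * f s * E)
        - of_real (deriv \<psi> s) * (\<i> * of_int k * mode_laplacian p q k f s * E)"
        by (simp add: mode_pdt mode_pd1 laplacian_mode twice_differentiable_cmult(1)[OF f])
           (simp add: mode_def E_def mode_laplacian_cmult[OF f])
      also have "\<dots> \<longleftrightarrow> E * ((lam + \<i> * of_int k * of_real (deriv \<psi> s)) * mode_laplacian p q k f s)
        = E * (\<i> * of_int k * of_int (norm_sq p) * of_real ((deriv ^^ 3) \<psi> s) * f s)"
        by (auto simp: algebra_simps)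
      also have "\<dots> \<longleftrightarrow> ?R" using \<open>E \<noteq> 0\<close> by simp
      finally show ?thesis .
    qed
    then show ?thesis
      unfolding linearised_euler_solution_def
      by (simp add: periodic_field_mode[OF assms(1)] mode_pdt(1) mode_pd1(1))
         (simp add: mode_pdt mode_pd1 twice_pd_mode twice_differentiable_cmult(1)[OF f])
  qed
  moreover have "twice_differentiable f" if ?L
    using that k
    by (auto simp: linearised_euler_solution_def mode_pd1 twice_pd_mode twice_differentiable_cmult_iff)
  ultimately show ?thesis by blast
qed

section \<open>The gauge transformation\<close>

definition twist :: "real \<Rightarrow> (real \<Rightarrow> complex) \<Rightarrow> real \<Rightarrow> complex"
  where "twist \<theta> F = (\<lambda>s. exp (\<i> * of_real \<theta> * of_real s) * F s)"

lemma twist_untwist: "twist (- \<theta>) (twist \<theta> F) = F"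
  by (simp add: twist_def fun_eq_iff mult.assoc[symmetric] exp_add[symmetric])

lemma twist_has_vector_derivative:
  assumes "(F has_vector_derivative F') (at s)"
  shows "(twist \<theta> F has_vector_derivative
    exp (\<i> * of_real \<theta> * of_real s) * (F' + \<i> * of_real \<theta> * F s)) (at s)"
proof -
  have "((\<lambda>s. exp (\<i> * of_real \<theta> * of_real s)) has_vector_derivative
      \<i> * of_real \<theta> * exp (\<i> * of_real \<theta> * of_real s)) (at s)"
    by (rule has_vector_derivative_eq_rhs,
        rule field_vector_diff_chain_at[where f = "\<lambda>s. \<i> * of_real \<theta> * of_real s" and g = exp, unfolded o_def])
       (auto intro!: derivative_eq_intros)
  from has_vector_derivative_mult[OF this assms] show ?thesis
    by (simp add: twist_def algebra_simps)
qed

lemma twice_differentiable_twist: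
  assumes "twice_differentiable F"
  shows "twice_differentiable (twist \<theta> F)"
    and "vd (twist \<theta> F) = twist \<theta> (\<lambda>s. vd F s + \<i> * of_real \<theta> * F s)"
    and "vd (vd (twist \<theta> F)) = twist \<theta> (\<lambda>s. vd (vd F) s + 2 * \<i> * of_real \<theta> * vd F s - (of_real \<theta>)\<^sup>2 * F s)"
proof -
  note d = twice_differentiableD[OF assms]
  have 1: "(twist \<theta> F has_vector_derivative twist \<theta> (\<lambda>s. vd F s + \<i> * of_real \<theta> * F s) s) (at s)" for s
    using twist_has_vector_derivative[OF d(1)] by (simp add: twist_def)
  have "((\<lambda>s. vd F s + \<i> * of_real \<theta> * F s) has_vector_derivative
      vd (vd F) s + \<i> * of_real \<theta> * vd F s) (at s)" for s
    by (intro has_vector_derivative_add has_vector_derivative_mult_right d)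
  from twist_has_vector_derivative[OF this, where \<theta> = \<theta>]
  have 2: "(twist \<theta> (\<lambda>s. vd F s + \<i> * of_real \<theta> * F s) has_vector_derivative
      twist \<theta> (\<lambda>s. vd (vd F) s + 2 * \<i> * of_real \<theta> * vd F s - (of_real \<theta>)\<^sup>2 * F s) s) (at s)" for s
    unfolding twist_def
    by (rule has_vector_derivative_eq_rhs) (simp add: algebra_simps power2_eq_square)
  show "twice_differentiable (twist \<theta> F)"
    and "vd (twist \<theta> F) = twist \<theta> (\<lambda>s. vd F s + \<i> * of_real \<theta> * F s)"
    and "vd (vd (twist \<theta> F)) = twist \<theta> (\<lambda>s. vd (vd F) s + 2 * \<i> * of_real \<theta> * vd F s - (of_real \<theta>)\<^sup>2 * F s)"
    using twice_differentiableI[OF 1 2] by simp_all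
qed

lemma twice_differentiable_twist_iff: "twice_differentiable (twist \<theta> F) \<longleftrightarrow> twice_differentiable F"
  using twice_differentiable_twist(1)[of F \<theta>] twice_differentiable_twist(1)[of "twist \<theta> F" "- \<theta>"]
  by (auto simp: twist_untwist)

text \<open>
  Lagrange's identity: the product of the squared lengths is the square of the dot product plus
  the square of the determinant, which is \<open>1\<close> here.
\<close>

lemma norm_sq_mult_unimodular:
  assumes "unimodular_partner p q"
  shows "norm_sq p * norm_sq q = (dot p q)\<^sup>2 + 1"
proof -
  have "norm_sq p * norm_sq q = (dot p q)\<^sup>2 + (snd p * fst q - fst p * snd q)\<^sup>2"
    by (simp add: norm_sq_def dot_def power2_eq_square algebra_simps)
  with assms show ?thesis by (simp add: unimodular_partner_def)
qed

lemma norm_sq_unimodular_nonzero: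
  assumes "unimodular_partner p q"
  shows "norm_sq p \<noteq> 0"
proof
  assume "norm_sq p = 0"
  with norm_sq_mult_unimodular[OF assms] have "(dot p q)\<^sup>2 + 1 = 0" by simp
  with zero_le_power2[of "dot p q"] show False by linarith
qed

text \<open>
  Completing the square. With \<open>p\<^sup>2 \<theta> = k p \<cdot> q\<close>, the second derivative of the twisted amplitude absorbs
  the first-order term at the cost of \<open>- p\<^sup>2 \<theta>\<^sup>2\<close>, and \<open>k\<^sup>2 q\<^sup>2 - p\<^sup>2 \<theta>\<^sup>2 = p\<^sup>2 \<mu>\<close> by Lagrange's identity.
\<close>

lemma mode_laplacian_twist:
  assumes uni: "unimodular_partner p q" and F: "twice_differentiable F"
    and \<mu>: "\<mu> = (of_int k)\<^sup>2 / (of_int (norm_sq p))\<^sup>2"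
    and \<theta>: "\<theta> = of_int k * of_int (dot p q) / of_int (norm_sq p)"
  shows "exp (\<i> * of_real \<theta> * of_real s) * mode_laplacian p q k F s
    = of_int (norm_sq p) * (vd (vd (twist \<theta> F)) s - of_real \<mu> * twist \<theta> F s)"
proof -
  define P D N K where "P = (of_int (norm_sq p) :: complex)" and "D = (of_int (dot p q) :: complex)"
    and "N = (of_int (norm_sq q) :: complex)" and "K = (of_int k :: complex)"
  have PN: "P * N = D\<^sup>2 + 1"
    unfolding P_def N_def D_def using norm_sq_mult_unimodular[OF uni]
    by (metis of_int_1 of_int_add of_int_mult of_int_power)
  have "norm_sq p \<noteq> 0"
    by (rule norm_sq_unimodular_nonzero[OF uni])
  then have P: "P \<noteq> 0" by (simp add: P_def)
  have t: "complex_of_real \<theta> = K * D / P" and m: "complex_of_real \<mu> = K\<^sup>2 / P\<^sup>2"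
    by (simp_all add: \<theta> \<mu> K_def D_def P_def)
  have e1: "P * (of_real \<theta>)\<^sup>2 + P * of_real \<mu> = K\<^sup>2 * N"
  proof -
    have "P * (of_real \<theta>)\<^sup>2 + P * of_real \<mu> = K\<^sup>2 * (D\<^sup>2 + 1) / P"
      using P unfolding t m by (simp add: field_simps power2_eq_square)
    then show ?thesis using P by (simp add: PN[symmetric])
  qed
  have e2: "P * of_real \<theta> = K * D" using P by (simp add: t)
  have "mode_laplacian p q k F s = P * vd (vd F) s + 2 * \<i> * (K * D) * vd F s - K\<^sup>2 * N * F s"
    by (simp add: mode_laplacian_def P_def D_def N_def K_def)
  also have "\<dots> = P * (vd (vd F) s + 2 * \<i> * of_real \<theta> * vd F s - (of_real \<theta>)\<^sup>2 * F s - of_real \<mu> * F s)"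
    unfolding e1[symmetric] e2[symmetric] by (simp add: algebra_simps)
  finally have S: "mode_laplacian p q k F s = \<dots>" .
  show ?thesis
    unfolding S twice_differentiable_twist(3)[OF F]
    by (simp add: twist_def P_def algebra_simps)
qed

section \<open>Boundary conditions and periodicity\<close>

lemma exp_quasi_shift:
  "exp (\<i> * of_real \<theta> * of_real (s + 2 * pi))
    = exp (2 * of_real pi * \<i> * of_real \<theta>) * exp (\<i> * of_real \<theta> * of_real s)"
  by (simp add: exp_add[symmetric] algebra_simps)

lemma periodic_iff_twist_quasi_periodic:
  "periodic_2pi f \<longleftrightarrow>
    (\<forall>s. twist \<theta> f (s + 2 * pi) = exp (2 * of_real pi * \<i> * of_real \<theta>) * twist \<theta> f s)"
  unfolding periodic_2pi_def twist_def exp_quasi_shift by (simp add: mult.assoc)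

lemma shift_has_vector_derivative:
  assumes "(F has_vector_derivative F') (at (s + a))"
  shows "((\<lambda>s. F (s + a)) has_vector_derivative F') (at (s::real))"
proof -
  have "((F \<circ> (\<lambda>s. s + a)) has_vector_derivative 1 *\<^sub>R F') (at s)"
    by (rule vector_diff_chain_at) (auto intro!: derivative_eq_intros assms)
  then show ?thesis by (simp add: o_def)
qed

text \<open>
  The condition on the slope results from differentiating the functional equation at \<open>0\<close>.
\<close>

lemma quasi_periodic_imp_bc:
  assumes qp: "\<And>s. g (s + 2 * pi) = exp (2 * of_real pi * \<i> * of_real \<theta>) * g s"
    and "twice_differentiable g"
  shows "quasi_periodic_bc \<theta> g"
proof -
  note d = twice_differentiableD(1)[OF assms(2)]
  let ?w = "exp (2 * of_real pi * \<i> * of_real \<theta>) :: complex"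
  have "((\<lambda>s. g (s + 2 * pi)) has_vector_derivative vd g (2 * pi)) (at 0)"
    by (rule shift_has_vector_derivative) (simp add: d)
  moreover have "((\<lambda>s. g (s + 2 * pi)) has_vector_derivative ?w * vd g 0) (at 0)"
    unfolding qp by (rule has_vector_derivative_mult_right[OF d])
  ultimately have "vd g (2 * pi) = ?w * vd g 0"
    by (rule vector_derivative_unique_at)
  with qp[of 0] show ?thesis by (simp add: quasi_periodic_bc_def vd_def)
qed

text \<open>
  Translation by a period and multiplication by a constant both preserve solutions of the equation,
  so the defect of quasi-periodicity is a solution, and the boundary conditions are its zero initial
  data at \<open>0\<close>.
\<close>

lemma hill_bc_imp_quasi_periodic:
  assumes hill: "hill_solution Q \<mu> g" and bc: "quasi_periodic_bc \<theta> g"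
    and Q: "periodic_2pi Q" "continuous_on UNIV Q"
  shows "g (s + 2 * pi) = exp (2 * of_real pi * \<i> * of_real \<theta>) * g s"
proof -
  let ?w = "exp (2 * of_real pi * \<i> * of_real \<theta>) :: complex"
  define R where "R = (\<lambda>s. of_real \<mu> - Q s)"
  have tw: "twice_differentiable g"
    using hill by (simp add: hill_solution_def twice_differentiable_def vd_def Let_def)
  note d = twice_differentiableD[OF tw]
  have g'': "vd (vd g) s = R s * g s" for s
  proof -
    have "vd (vd g) s + Q s * g s = of_real \<mu> * g s"
      using hill by (simp add: hill_solution_def vd_def Let_def)
    then show ?thesis by (simp add: R_def algebra_simps eq_diff_eq)
  qed
  have Rp: "R (s + 2 * pi) = R s" for s
    using Q(1) by (simp add: R_def periodic_2pi_def)
  have "g (s + 2 * pi) - ?w * g s = 0"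
  proof (rule linear_ode_unique[where R = R and h = "\<lambda>s. g (s + 2 * pi) - ?w * g s"
        and h' = "\<lambda>s. vd g (s + 2 * pi) - ?w * vd g s"])
    fix s
    show "((\<lambda>s. g (s + 2 * pi) - ?w * g s) has_vector_derivative
        vd g (s + 2 * pi) - ?w * vd g s) (at s)"
      by (intro has_vector_derivative_diff has_vector_derivative_mult_right
          shift_has_vector_derivative d)
    have "((\<lambda>s. vd g (s + 2 * pi) - ?w * vd g s) has_vector_derivative
        vd (vd g) (s + 2 * pi) - ?w * vd (vd g) s) (at s)"
      by (intro has_vector_derivative_diff has_vector_derivative_mult_right
          shift_has_vector_derivative d)
    then show "((\<lambda>s. vd g (s + 2 * pi) - ?w * vd g s) has_vector_derivative
        R s * (g (s + 2 * pi) - ?w * g s)) (at s)"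
      by (simp only: g'' Rp) (simp add: algebra_simps)
  next
    show "continuous_on UNIV R"
      unfolding R_def by (intro continuous_intros Q)
  qed (use bc in \<open>simp_all add: quasi_periodic_bc_def vd_def\<close>)
  then show ?thesis by simp
qed

section \<open>Modes and Hill's equation\<close>

theorem proposition2p1:
  fixes p q :: "int \<times> int" and \<psi> :: "real \<Rightarrow> real" and k :: int
    and lam c :: complex and \<mu> \<theta> :: real and Q f g :: "real \<Rightarrow> complex"
  assumes "coprime (fst p) (snd p)"
    and "minimal_partner p q"
    and "smooth \<psi>" and "periodic_2pi \<psi>"
    and "k \<noteq> 0"
    and "\<mu> = (of_int k)\<^sup>2 / (of_int (norm_sq p))\<^sup>2"
    and "c = \<i> * lam / of_int k"
    and "\<theta> = of_int k * of_int (dot p q) / of_int (norm_sq p)"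
    and "c \<notin> range (\<lambda>\<eta>. complex_of_real (deriv \<psi> \<eta>))"
    and "Q = (\<lambda>\<eta>. of_real ((deriv ^^ 3) \<psi> \<eta>) / (c - of_real (deriv \<psi> \<eta>)))"
    and "g = (\<lambda>\<eta>. exp (\<i> * of_real \<theta> * of_real \<eta>) * f \<eta>)"
  shows "euler_steady_state (\<lambda>x y. \<psi> (of_int (fst p) * x + of_int (snd p) * y)) \<and>
    ((periodic_2pi f \<and> linearised_euler_solution p q \<psi> (mode f k lam)) \<longleftrightarrow>
     (hill_solution Q \<mu> g \<and> quasi_periodic_bc \<theta> g))"
proof -
  have uni: "unimodular_partner p q" using assms(2) by (simp add: minimal_partner_def)
  have P: "norm_sq p \<noteq> 0"
    by (rule norm_sq_unimodular_nonzero[OF uni])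
  have g: "g = twist \<theta> f" by (simp add: assms(11) twist_def)
  have c: "c - of_real (deriv \<psi> s) \<noteq> 0" for s using assms(9) by auto
  have lam: "lam = - \<i> * of_int k * c" using assms(5) by (simp add: assms(7) field_simps)
  have Qper: "periodic_2pi Q"
    using periodic_deriv[OF assms(4), of 3] periodic_deriv[OF assms(4), of 1]
    by (simp add: assms(10) periodic_2pi_def)
  have Qcont: "continuous_on UNIV Q"
    using smooth_continuous[OF assms(3), of 3] smooth_continuous[OF assms(3), of 1] c
    unfolding assms(10) by (auto intro!: continuous_intros)
  \<comment> \<open>Substituting \<open>\<lambda> = - \<i> k c\<close> turns the left factor into \<open>- \<i> k (c - \<psi>')\<close>. The two equations then
    differ by the factors \<open>\<i> k\<close>, \<open>exp (\<i> \<theta> \<eta>)\<close> and \<open>p\<^sup>2 (c - \<psi>')\<close>, all nonzero.\<close>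
  have eq: "(lam + \<i> * of_int k * of_real (deriv \<psi> s)) * mode_laplacian p q k f s
        = \<i> * of_int k * of_int (norm_sq p) * of_real ((deriv ^^ 3) \<psi> s) * f s
      \<longleftrightarrow> vd (vd g) s + Q s * g s = of_real \<mu> * g s" (is "?A \<longleftrightarrow> ?B")
    if f: "twice_differentiable f" for s
  proof -
    define e where "e = exp (\<i> * of_real \<theta> * of_real s)"
    define C where "C = c - of_real (deriv \<psi> s)"
    define d where "d = complex_of_real ((deriv ^^ 3) \<psi> s)"
    define S where "S = mode_laplacian p q k f s"
    define Pc where "Pc = (of_int (norm_sq p) :: complex)"
    have nz: "e \<noteq> 0" "C \<noteq> 0" "Pc \<noteq> 0" "\<i> * of_int k \<noteq> (0::complex)"
      using c P assms(5) by (simp_all add: e_def C_def Pc_def)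
    have S: "e * S = Pc * (vd (vd g) s - of_real \<mu> * g s)"
      unfolding e_def S_def Pc_def g by (rule mode_laplacian_twist[OF uni f assms(6) assms(8)])
    have ge: "g s = e * f s" by (simp add: assms(11) e_def)
    have Qs: "Q s = d / C" by (simp add: assms(10) d_def C_def)
    have "?A \<longleftrightarrow> (\<i> * of_int k) * (- C * S) = (\<i> * of_int k) * (Pc * d * f s)"
      by (simp add: lam C_def d_def S_def Pc_def algebra_simps)
    also have "\<dots> \<longleftrightarrow> - C * S = Pc * d * f s"
      by (rule mult_left_cancel[OF nz(4)])
    also have "\<dots> \<longleftrightarrow> e * (- C * S) = e * (Pc * d * f s)"
      by (rule mult_left_cancel[OF nz(1), symmetric])
    also have "\<dots> \<longleftrightarrow> - C * (e * S) = Pc * d * g s" by (simp add: ge algebra_simps)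
    also have "\<dots> \<longleftrightarrow> (Pc * C) * (vd (vd g) s + Q s * g s) = (Pc * C) * (of_real \<mu> * g s)"
    proof -
      have CQ: "C * Q s = d" using nz(2) by (simp add: Qs)
      have "(Pc * C) * (vd (vd g) s + Q s * g s) - (Pc * C) * (of_real \<mu> * g s)
          = Pc * (C * Q s) * g s - (- C * (Pc * (vd (vd g) s - of_real \<mu> * g s)))"
        by (simp add: algebra_simps)
      also have "\<dots> = Pc * d * g s - (- C * (e * S))"
        by (simp only: S CQ)
      finally show ?thesis by (metis eq_iff_diff_eq_0)
    qed
    also have "\<dots> \<longleftrightarrow> ?B" using nz by simp
    finally show ?thesis .
  qed
  have hill: "hill_solution Q \<mu> g \<longleftrightarrow>
      twice_differentiable g \<and> (\<forall>s. vd (vd g) s + Q s * g s = of_real \<mu> * g s)"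
    by (simp add: hill_solution_def twice_differentiable_def vd_def Let_def)
  have tw: "twice_differentiable g \<longleftrightarrow> twice_differentiable f"
    by (simp add: g twice_differentiable_twist_iff)
  have equiv: "linearised_euler_solution p q \<psi> (mode f k lam) \<longleftrightarrow> hill_solution Q \<mu> g"
    if "periodic_2pi f"
    unfolding linearised_mode_iff[OF that assms(5)] hill tw using eq by blast
  have "quasi_periodic_bc \<theta> g" if "periodic_2pi f" "hill_solution Q \<mu> g"
    using quasi_periodic_imp_bc[of g \<theta>] that periodic_iff_twist_quasi_periodic[of f \<theta>] hill g by blast
  moreover have "periodic_2pi f" if "hill_solution Q \<mu> g" "quasi_periodic_bc \<theta> g"
    using hill_bc_imp_quasi_periodic[OF that Qper Qcont]
    by (simp add: periodic_iff_twist_quasi_periodic[of f \<theta>] g)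
  ultimately show ?thesis
    using plane_wave_steady[OF assms(3,4)] equiv by blast
qed

end
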